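(* Let $J\ge 2$, let $(\eta_j)_{j=1}^J$, $(k_j)_{j=1}^J$ be as in the context, and fix an initial capital $\mathcal{E}_0>0$. Then for every integer $t\ge 1$, every string of winning horses $(j_1,\dots,j_t)\in\{1,\dots,J\}^t$, and every one-mode Gaussian input state $\hat\rho_0$ with parameters $(m,\zeta,n)$, $m\in\mathbb{R}^2$, $\zeta\in\mathbb{C}$, $n\ge 0$, having ergotropy $\mathcal{E}(\hat\rho_0)=\mathcal{E}_0$, the renormalized output ergotropy $\bar\mu_t$ and the output ergotropy ratio $\bar r_t$ satisfy $$\bar\mu_t\le 1,\qquad \bar r_t\le \frac{\mathcal{E}_0}{\mathcal{E}_0+\bar\gamma_t+\tfrac12},$$ where $\bar\gamma_t=\sum_{\ell=1}^t \alpha_{j_\ell}/\bar g_\ell^2$ does not depend on $\hat\rho_0$. Moreover both bounds are attained with equality, for every $t$ and every string $(j_1,\dots,j_t)$, when $\hat\rho_0$ is a pure coherent state with ergotropy $\mathcal{E}_0$, i.e. when $\zeta=0$, $n=0$ and $m^Tm=2\mathcal{E}_0$. Hence, for fixed $\mathcal{E}_0$ and fixed $(\eta_j)$, among Gaussian input states the pure coherent state simultaneously maximizes $\bar\mu_t$ and $\bar r_t$ along every trajectory.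
   Context: Model parameters. The numbers $\eta_j\in(0,1)$ satisfy $\sum_{j=1}^J\eta_j^2=1$, and the numbers $k_j>1$ satisfy $\sum_{j=1}^J 1/k_j^2\le 1$ (fair or super-fair odds). For each $j$ put $$g_j:=k_j\eta_j>0,\qquad \alpha_j:=\frac{k_j^2(1-\eta_j^2)+k_j^2-1}{2}>0 .$$ For a string $j_1,j_2,\dots$ in $\{1,\dots,J\}$ put $\bar g_t:=g_{j_t}\cdots g_{j_1}$. Gaussian states. A one-mode Gaussian state $\hat\rho$ is determined by its first-moment vector $m\in\mathbb{R}^2$ and its real symmetric $2\times2$ covariance matrix $\sigma$ (normalized so that the vacuum has $\sigma=\mathbb{I}$). It is parametrized by $m\in\mathbb{R}^2$, $\zeta=|\zeta|e^{i\varphi}\in\mathbb{C}$, $n\ge0$, with $$\sigma=(2n+1)\big[\cosh(2|\zeta|)\,\mathbb{I}+\sinh(2|\zeta|)(\sin\varphi\,\sigma_1-\cos\varphi\,\sigma_3)\big],$$ where $\sigma_1=\begin{pmatrix}0&1\\1&0\end{pmatrix}$ and $\sigma_3=\begin{pmatrix}1&0\\0&-1\end{pmatrix}$. Its mean energy (in units $h\nu=1$) and its ergotropy are $$E(\hat\rho)=\frac{\mathrm{Tr}(\sigma)}{4}+\frac{m^Tm}{2},\qquad \mathcal{E}(\hat\rho)=\frac{\mathrm{Tr}(\sigma)}{4}+\frac{m^Tm}{2}-\frac{\sqrt{\det\sigma}}{2}=\frac{(2n+1)(\cosh(2|\zeta|)-1)+m^Tm}{2}.$$ Dynamics. The channel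 $\Phi_j$ maps a Gaussian state with moments $(m,\sigma)$ to the Gaussian state with moments $(g_j m,\; g_j^2\sigma+2\alpha_j\mathbb{I})$. Given an input $\hat\rho_0$ and a string $j_1,\dots,j_t$, set $\hat\rho_t:=\Phi_{j_t}\circ\cdots\circ\Phi_{j_1}(\hat\rho_0)$. Figures of merit (for $\mathcal{E}(\hat\rho_0)=\mathcal{E}_0>0$): $$\bar\mu_t:=\frac{\mathcal{E}(\hat\rho_t)}{\bar g_t^2\,\mathcal{E}_0},\qquad \bar r_t:=\frac{\mathcal{E}(\hat\rho_t)}{E(\hat\rho_t)} .$$ *)

theory Defs
  imports "HOL-Analysis.Analysis"
begin

text \<open>
  A one-mode Gaussian state is represented by the data that determine it: the first-moment vector
  and the covariance matrix, normalised so that the vacuum has covariance \<open>mat 1\<close>. The record type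
  also contains unphysical pairs of moments; states are singled out by \<open>gaussian_state\<close> below.
\<close>

record gaussian =
  mean :: "real^2"
  cov :: "real^2^2"

definition pauli1 :: "real^2^2" where
  "pauli1 = vector [vector [0, 1], vector [1, 0]]"

definition pauli3 :: "real^2^2" where
  "pauli3 = vector [vector [1, 0], vector [0, -1]]"

text \<open>
  The phase of the squeezing parameter \<open>\<zeta>\<close> is \<open>Arg \<zeta>\<close>; at \<open>\<zeta> = 0\<close> it is
  irrelevant because \<open>sinh 0 = 0\<close>.
\<close>

definition gaussian_cov :: "complex \<Rightarrow> real \<Rightarrow> real^2^2" where
  "gaussian_cov \<zeta> n =
     (2 * n + 1) *\<^sub>R
       (cosh (2 * cmod \<zeta>) *\<^sub>R mat 1
        + sinh (2 * cmod \<zeta>) *\<^sub>R (sin (Arg \<zeta>) *\<^sub>R pauli1 - cos (Arg \<zeta>) *\<^sub>R pauli3))"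

definition gaussian_of_params :: "real^2 \<Rightarrow> complex \<Rightarrow> real \<Rightarrow> gaussian" where
  "gaussian_of_params m \<zeta> n = \<lparr>mean = m, cov = gaussian_cov \<zeta> n\<rparr>"

definition gaussian_state :: "gaussian \<Rightarrow> bool" where
  "gaussian_state \<rho> \<longleftrightarrow> (\<exists>m \<zeta> n. n \<ge> 0 \<and> \<rho> = gaussian_of_params m \<zeta> n)"

definition coherent_state :: "real^2 \<Rightarrow> gaussian" where
  "coherent_state m = gaussian_of_params m 0 0"

definition energy :: "gaussian \<Rightarrow> real" where
  "energy \<rho> = trace (cov \<rho>) / 4 + (mean \<rho> \<bullet> mean \<rho>) / 2"

definition ergotropy :: "gaussian \<Rightarrow> real" where
  "ergotropy \<rho> = trace (cov \<rho>) / 4 + (mean \<rho> \<bullet> mean \<rho>) / 2 - sqrt (det (cov \<rho>)) / 2"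

lemma ergotropy_gaussian_of_params:
  assumes "n \<ge> 0"
  shows "ergotropy (gaussian_of_params m \<zeta> n) =
           ((2 * n + 1) * (cosh (2 * cmod \<zeta>) - 1) + m \<bullet> m) / 2"
proof -
  define c where "c = cosh (2 * cmod \<zeta>)"
  define s where "s = sinh (2 * cmod \<zeta>)"
  define x where "x = cos (Arg \<zeta>)"
  define y where "y = sin (Arg \<zeta>)"
  have cs: "c\<^sup>2 = s\<^sup>2 + 1" unfolding c_def s_def by (rule cosh_square_eq)
  have xy: "x\<^sup>2 + y\<^sup>2 = 1" by (simp add: x_def y_def)
  have "det (gaussian_cov \<zeta> n) = (2 * n + 1)\<^sup>2 * (c\<^sup>2 - s\<^sup>2 * (x\<^sup>2 + y\<^sup>2))"
    unfolding gaussian_cov_def c_def[symmetric] s_def[symmetric] x_def[symmetric] y_def[symmetric]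
    by (simp add: det_2 mat_def pauli1_def pauli3_def power2_eq_square algebra_simps)
  then have "det (gaussian_cov \<zeta> n) = (2 * n + 1)\<^sup>2"
    by (simp add: xy cs)
  then have d: "sqrt (det (gaussian_cov \<zeta> n)) = 2 * n + 1"
    using assms by simp
  have t: "trace (gaussian_cov \<zeta> n) = 2 * (2 * n + 1) * c"
    unfolding gaussian_cov_def c_def[symmetric] s_def[symmetric] x_def[symmetric] y_def[symmetric]
    by (simp add: trace_def sum_2 mat_def pauli1_def pauli3_def algebra_simps)
  show ?thesis
    unfolding c_def[symmetric] by (simp add: ergotropy_def gaussian_of_params_def d t field_simps)
qed

definition gain :: "(nat \<Rightarrow> real) \<Rightarrow> (nat \<Rightarrow> real) \<Rightarrow> nat \<Rightarrow> real" where
  "gain \<eta> k j = k j * \<eta> j"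

definition noise :: "(nat \<Rightarrow> real) \<Rightarrow> (nat \<Rightarrow> real) \<Rightarrow> nat \<Rightarrow> real" where
  "noise \<eta> k j = ((k j)\<^sup>2 * (1 - (\<eta> j)\<^sup>2) + (k j)\<^sup>2 - 1) / 2"

definition channel :: "(nat \<Rightarrow> real) \<Rightarrow> (nat \<Rightarrow> real) \<Rightarrow> nat \<Rightarrow> gaussian \<Rightarrow> gaussian" where
  "channel \<eta> k j \<rho> =
     \<lparr>mean = gain \<eta> k j *\<^sub>R mean \<rho>,
      cov = (gain \<eta> k j)\<^sup>2 *\<^sub>R cov \<rho> + (2 * noise \<eta> k j) *\<^sub>R mat 1\<rparr>"

text \<open>
  A string of winning horses is a function \<open>js\<close> whose value \<open>js l\<close> is the winner of race
  \<open>l \<ge> 1\<close>; the quantities at time \<open>t\<close> only use \<open>js 1, \<dots>, js t\<close>.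
\<close>

fun output_state :: "(nat \<Rightarrow> real) \<Rightarrow> (nat \<Rightarrow> real) \<Rightarrow> (nat \<Rightarrow> nat) \<Rightarrow> gaussian \<Rightarrow> nat \<Rightarrow> gaussian" where
  "output_state \<eta> k js \<rho> 0 = \<rho>"
| "output_state \<eta> k js \<rho> (Suc t) = channel \<eta> k (js (Suc t)) (output_state \<eta> k js \<rho> t)"

definition total_gain :: "(nat \<Rightarrow> real) \<Rightarrow> (nat \<Rightarrow> real) \<Rightarrow> (nat \<Rightarrow> nat) \<Rightarrow> nat \<Rightarrow> real" where
  "total_gain \<eta> k js t = (\<Prod>l = 1..t. gain \<eta> k (js l))"

definition total_noise :: "(nat \<Rightarrow> real) \<Rightarrow> (nat \<Rightarrow> real) \<Rightarrow> (nat \<Rightarrow> nat) \<Rightarrow> nat \<Rightarrow> real" where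
  "total_noise \<eta> k js t = (\<Sum>l = 1..t. noise \<eta> k (js l) / (total_gain \<eta> k js l)\<^sup>2)"

definition renormalized_ergotropy ::
  "(nat \<Rightarrow> real) \<Rightarrow> (nat \<Rightarrow> real) \<Rightarrow> (nat \<Rightarrow> nat) \<Rightarrow> nat \<Rightarrow> gaussian \<Rightarrow> real" where
  "renormalized_ergotropy \<eta> k js t \<rho> =
     ergotropy (output_state \<eta> k js \<rho> t) / ((total_gain \<eta> k js t)\<^sup>2 * ergotropy \<rho>)"

definition ergotropy_ratio ::
  "(nat \<Rightarrow> real) \<Rightarrow> (nat \<Rightarrow> real) \<Rightarrow> (nat \<Rightarrow> nat) \<Rightarrow> nat \<Rightarrow> gaussian \<Rightarrow> real" where
  "ergotropy_ratio \<eta> k js t \<rho> =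
     ergotropy (output_state \<eta> k js \<rho> t) / energy (output_state \<eta> k js \<rho> t)"

end

(*
  A string of channels acts as one channel: the mean is scaled by the total gain G and the covariance
  \<sigma> becomes G^2 (\<sigma> + 2 \<gamma> I).  The energy of the output is therefore G^2 (E + \<gamma>), and only the term
  sqrt (det (\<sigma> + 2 \<gamma> I)) has to be bounded.  By AM-GM on the eigenvalues of \<sigma> it is at least
  sqrt (det \<sigma>) + 2 \<gamma>, with equality when \<sigma> is a multiple of I.  This gives
  the bound on \<mu>; dividing it by E + \<gamma> = E0 + sqrt (det \<sigma>) / 2 + \<gamma> and using det \<sigma> >= 1 gives the bound
  on the ratio.
*)
theory Submission
  imports Defs
begin

section \<open>Trace and determinant of shifted 2x2 matrices\<close>

lemma trace_add_scaleR_mat1: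
  fixes A :: "real^2^2"
  shows "trace (A + d *\<^sub>R mat 1) = trace A + 2 * d"
  by (simp add: trace_def sum_2 mat_def)

text \<open>This is the characteristic polynomial of \<open>- A\<close> evaluated at
  \<open>d\<close>.\<close>

lemma det_add_scaleR_mat1:
  fixes A :: "real^2^2"
  shows "det (A + d *\<^sub>R mat 1) = det A + d * trace A + d\<^sup>2"
  by (simp add: det_2 trace_def sum_2 mat_def power2_eq_square algebra_simps)

lemma det_scaleR_2:
  fixes A :: "real^2^2"
  shows "det (c *\<^sub>R A) = c\<^sup>2 * det A"
  by (simp add: det_2 power2_eq_square algebra_simps)

lemma trace_scaleR:
  fixes A :: "real^'n^'n"
  shows "trace (c *\<^sub>R A) = c * trace A"
  by (simp add: trace_def sum_distrib_left)

text \<open>After squaring, both sides are quadratics in \<open>d\<close> that differ only in the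
  linear coefficient. The second assumption, AM-GM for the eigenvalues, compares these
  coefficients.\<close>

lemma sqrt_det_add_scaleR_mat1_ge:
  fixes A :: "real^2^2"
  assumes "0 \<le> det A" "2 * sqrt (det A) \<le> trace A" "0 \<le> d"
  shows "sqrt (det A) + d \<le> sqrt (det (A + d *\<^sub>R mat 1))"
proof (rule real_le_rsqrt)
  have "(sqrt (det A) + d)\<^sup>2 = det A + d * (2 * sqrt (det A)) + d\<^sup>2"
    using assms(1) by (simp add: power2_sum)
  also have "\<dots> \<le> det A + d * trace A + d\<^sup>2"
    using assms by (simp add: mult_left_mono)
  finally show "(sqrt (det A) + d)\<^sup>2 \<le> det (A + d *\<^sub>R mat 1)"
    by (simp add: det_add_scaleR_mat1)
qed

section \<open>Covariance matrices of Gaussian states\<close>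

lemma trace_gaussian_cov: "trace (gaussian_cov \<zeta> n) = 2 * (2 * n + 1) * cosh (2 * cmod \<zeta>)"
proof -
  have "trace (c *\<^sub>R mat 1 + s *\<^sub>R (y *\<^sub>R pauli1 - x *\<^sub>R pauli3)) = 2 * c" for c s x y
    by (simp add: trace_def sum_2 mat_def pauli1_def pauli3_def)
  then show ?thesis by (simp add: gaussian_cov_def trace_scaleR)
qed

text \<open>Squeezing preserves phase-space area: its factor has determinant cosh^2 - sinh^2 = 1, so
  only the thermal factor is left.\<close>

lemma det_gaussian_cov: "det (gaussian_cov \<zeta> n) = (2 * n + 1)\<^sup>2"
proof -
  have "det (c *\<^sub>R mat 1 + s *\<^sub>R (y *\<^sub>R pauli1 - x *\<^sub>R pauli3)) = c\<^sup>2 - s\<^sup>2 * (x\<^sup>2 + y\<^sup>2)" for c s x y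
    by (simp add: det_2 mat_def pauli1_def pauli3_def power2_eq_square algebra_simps)
  then show ?thesis by (simp add: gaussian_cov_def det_scaleR_2 cosh_square_eq)
qed

text \<open>The two bounds below use physicality of a state only through these facts: the
  uncertainty relation (from \<open>n \<ge> 0\<close>) and AM-GM for the eigenvalues (from cosh >=
  1).\<close>

lemma gaussian_state_sqrt_det_cov:
  assumes "gaussian_state \<rho>"
  shows "1 \<le> sqrt (det (cov \<rho>))" and "2 * sqrt (det (cov \<rho>)) \<le> trace (cov \<rho>)"
proof -
  obtain m \<zeta> n where n: "n \<ge> 0" and \<rho>: "\<rho> = gaussian_of_params m \<zeta> n"
    using assms by (auto simp: gaussian_state_def)
  have d: "sqrt (det (cov \<rho>)) = 2 * n + 1"
    using n by (simp add: \<rho> gaussian_of_params_def det_gaussian_cov)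
  show "1 \<le> sqrt (det (cov \<rho>))" using n by (simp add: d)
  have "(2 * n + 1) * 1 \<le> (2 * n + 1) * cosh (2 * cmod \<zeta>)"
    using n by (intro mult_left_mono cosh_real_ge_1) auto
  then show "2 * sqrt (det (cov \<rho>)) \<le> trace (cov \<rho>)"
    unfolding d by (simp add: \<rho> gaussian_of_params_def trace_gaussian_cov del: distrib_left_numeral)
qed

lemma energy_eq_ergotropy_plus: "energy \<rho> = ergotropy \<rho> + sqrt (det (cov \<rho>)) / 2"
  by (simp add: energy_def ergotropy_def)

section \<open>The composed channel\<close>

lemma total_gain_Suc: "total_gain \<eta> k js (Suc t) = gain \<eta> k (js (Suc t)) * total_gain \<eta> k js t"
  by (simp add: total_gain_def)

lemma total_gain_nonzero:
  assumes "\<forall>l \<in> {1..t}. gain \<eta> k (js l) \<noteq> 0"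
  shows "total_gain \<eta> k js t \<noteq> 0"
  using assms by (simp add: total_gain_def)

text \<open>Noise added in race \<open>l\<close> is amplified by the later gains only. Factoring out
  the full squared gain therefore divides it by the squared gain up to \<open>l\<close>, which is
  the weight in \<open>total_noise\<close>; the gains must be nonzero for this.\<close>

lemma output_state_eq:
  assumes "\<forall>l \<in> {1..t}. gain \<eta> k (js l) \<noteq> 0"
  shows "output_state \<eta> k js \<rho> t =
    \<lparr>mean = total_gain \<eta> k js t *\<^sub>R mean \<rho>,
     cov = (total_gain \<eta> k js t)\<^sup>2 *\<^sub>R (cov \<rho> + (2 * total_noise \<eta> k js t) *\<^sub>R mat 1)\<rparr>"
  using assms
proof (induction t)
  case 0
  show ?case by (simp add: total_gain_def total_noise_def)
next
  case (Suc t)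
  have G: "total_gain \<eta> k js (Suc t) \<noteq> 0"
    using Suc.prems by (rule total_gain_nonzero)
  have noise: "(total_gain \<eta> k js (Suc t))\<^sup>2 * total_noise \<eta> k js (Suc t) =
      (total_gain \<eta> k js (Suc t))\<^sup>2 * total_noise \<eta> k js t + noise \<eta> k (js (Suc t))"
    using G by (simp add: total_noise_def distrib_left)
  \<comment> \<open>The right-hand side is the last channel acting on the covariance that the
    induction hypothesis provides.\<close>
  have cov: "(total_gain \<eta> k js (Suc t))\<^sup>2 *\<^sub>R (A + (2 * total_noise \<eta> k js (Suc t)) *\<^sub>R mat 1) =
      (gain \<eta> k (js (Suc t)))\<^sup>2 *\<^sub>R
        ((total_gain \<eta> k js t)\<^sup>2 *\<^sub>R (A + (2 * total_noise \<eta> k js t) *\<^sub>R mat 1))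
      + (2 * noise \<eta> k (js (Suc t))) *\<^sub>R mat 1" for A :: "real^2^2"
  proof -
    have "(total_gain \<eta> k js (Suc t))\<^sup>2 *\<^sub>R (A + (2 * total_noise \<eta> k js (Suc t)) *\<^sub>R mat 1) =
      (total_gain \<eta> k js (Suc t))\<^sup>2 *\<^sub>R A +
      (2 * ((total_gain \<eta> k js (Suc t))\<^sup>2 * total_noise \<eta> k js (Suc t))) *\<^sub>R mat 1"
      by (simp add: scaleR_add_right mult.left_commute)
    also have "\<dots> = (total_gain \<eta> k js (Suc t))\<^sup>2 *\<^sub>R (A + (2 * total_noise \<eta> k js t) *\<^sub>R mat 1)
      + (2 * noise \<eta> k (js (Suc t))) *\<^sub>R mat 1"
      unfolding noise by (simp add: scaleR_add_right distrib_left scaleR_add_left mult.left_commute)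
    finally show ?thesis by (simp add: total_gain_Suc power_mult_distrib)
  qed
  have "output_state \<eta> k js \<rho> t =
    \<lparr>mean = total_gain \<eta> k js t *\<^sub>R mean \<rho>,
     cov = (total_gain \<eta> k js t)\<^sup>2 *\<^sub>R (cov \<rho> + (2 * total_noise \<eta> k js t) *\<^sub>R mat 1)\<rparr>"
    using Suc by auto
  then show ?case
    unfolding output_state.simps cov by (simp add: channel_def total_gain_Suc)
qed

text \<open>The energy is linear in the covariance, and adding \<open>2 * total_noise\<close> times
  the identity raises trace / 4 by \<open>total_noise\<close>.\<close>

lemma energy_output_state:
  assumes "\<forall>l \<in> {1..t}. gain \<eta> k (js l) \<noteq> 0"
  shows "energy (output_state \<eta> k js \<rho> t) =
    (total_gain \<eta> k js t)\<^sup>2 * (energy \<rho> + total_noise \<eta> k js t)"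
  unfolding output_state_eq[OF assms]
  by (simp add: energy_def trace_scaleR trace_add_scaleR_mat1)
     (simp add: power2_eq_square field_simps)

lemma ergotropy_output_state:
  assumes "\<forall>l \<in> {1..t}. gain \<eta> k (js l) \<noteq> 0"
  shows "ergotropy (output_state \<eta> k js \<rho> t) =
    (total_gain \<eta> k js t)\<^sup>2 * (energy \<rho> + total_noise \<eta> k js t
      - sqrt (det (cov \<rho> + (2 * total_noise \<eta> k js t) *\<^sub>R mat 1)) / 2)"
proof -
  have "ergotropy (output_state \<eta> k js \<rho> t) =
    energy (output_state \<eta> k js \<rho> t) - sqrt (det (cov (output_state \<eta> k js \<rho> t))) / 2"
    by (simp add: energy_eq_ergotropy_plus)
  \<comment> \<open>In dimension two the determinant scales with the fourth power of the gain, so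
    its root scales like the energy.\<close>
  also have "sqrt (det (cov (output_state \<eta> k js \<rho> t))) =
    (total_gain \<eta> k js t)\<^sup>2 * sqrt (det (cov \<rho> + (2 * total_noise \<eta> k js t) *\<^sub>R mat 1))"
    unfolding output_state_eq[OF assms]
    by (simp only: gaussian.simps det_scaleR_2 real_sqrt_mult real_sqrt_abs abs_power2)
  finally show ?thesis
    unfolding energy_output_state[OF assms] by (simp add: algebra_simps)
qed

section \<open>Upper bounds for arbitrary Gaussian inputs\<close>

lemma total_noise_nonneg:
  assumes "\<forall>l \<in> {1..t}. 0 \<le> noise \<eta> k (js l)"
  shows "0 \<le> total_noise \<eta> k js t"
  unfolding total_noise_def using assms by (intro sum_nonneg divide_nonneg_nonneg) auto

text \<open>The noise raises the energy by \<gamma>, but it raises half the root of the determinant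
  by at least as much, so the rescaled ergotropy cannot grow.\<close>

lemma renormalized_ergotropy_le_1:
  assumes gain: "\<forall>l \<in> {1..t}. gain \<eta> k (js l) \<noteq> 0"
    and noise: "0 \<le> total_noise \<eta> k js t"
    and \<rho>: "gaussian_state \<rho>" "0 < ergotropy \<rho>"
  shows "renormalized_ergotropy \<eta> k js t \<rho> \<le> 1"
proof -
  have "sqrt (det (cov \<rho>)) + 2 * total_noise \<eta> k js t
      \<le> sqrt (det (cov \<rho> + (2 * total_noise \<eta> k js t) *\<^sub>R mat 1))"
    using gaussian_state_sqrt_det_cov[OF \<rho>(1)] noise
    by (intro sqrt_det_add_scaleR_mat1_ge) (auto intro: order.trans[of 0 1])
  then have "ergotropy (output_state \<eta> k js \<rho> t) \<le> (total_gain \<eta> k js t)\<^sup>2 * ergotropy \<rho>"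
    unfolding ergotropy_output_state[OF gain] energy_eq_ergotropy_plus
    by (intro mult_left_mono) auto
  moreover have "0 < (total_gain \<eta> k js t)\<^sup>2 * ergotropy \<rho>"
    using total_gain_nonzero[OF gain] \<rho>(2) by simp
  ultimately show ?thesis by (simp add: renormalized_ergotropy_def)
qed

lemma ergotropy_ratio_le:
  assumes gain: "\<forall>l \<in> {1..t}. gain \<eta> k (js l) \<noteq> 0"
    and noise: "0 \<le> total_noise \<eta> k js t"
    and \<rho>: "gaussian_state \<rho>" "0 < ergotropy \<rho>"
  shows "ergotropy_ratio \<eta> k js t \<rho> \<le>
    ergotropy \<rho> / (ergotropy \<rho> + total_noise \<eta> k js t + 1 / 2)"
proof -
  define E where "E = energy \<rho> + total_noise \<eta> k js t"
  have p: "1 \<le> sqrt (det (cov \<rho>))" using gaussian_state_sqrt_det_cov[OF \<rho>(1)] by simp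
  \<comment> \<open>The summand 1/2 is the vacuum energy: half the root of the determinant, which is
    at least 1.\<close>
  have E: "E > 0" "ergotropy \<rho> + total_noise \<eta> k js t + 1 / 2 \<le> E"
    using p \<rho>(2) noise unfolding E_def energy_eq_ergotropy_plus by linarith+
  have G: "0 < (total_gain \<eta> k js t)\<^sup>2"
    using total_gain_nonzero[OF gain] by simp
  have "renormalized_ergotropy \<eta> k js t \<rho> \<le> 1"
    using assms by (rule renormalized_ergotropy_le_1)
  then have "ergotropy (output_state \<eta> k js \<rho> t) \<le> (total_gain \<eta> k js t)\<^sup>2 * ergotropy \<rho>"
    using G \<rho>(2) by (simp add: renormalized_ergotropy_def)
  then have "ergotropy_ratio \<eta> k js t \<rho> \<le>
      ((total_gain \<eta> k js t)\<^sup>2 * ergotropy \<rho>) / ((total_gain \<eta> k js t)\<^sup>2 * E)"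
    unfolding ergotropy_ratio_def energy_output_state[OF gain] E_def[symmetric]
    using E(1) by (intro divide_right_mono) auto
  also have "\<dots> = ergotropy \<rho> / E" using G by simp
  also have "\<dots> \<le> ergotropy \<rho> / (ergotropy \<rho> + total_noise \<eta> k js t + 1 / 2)"
    using E \<rho>(2) noise by (intro divide_left_mono) auto
  finally show ?thesis .
qed

section \<open>Coherent states attain the bounds\<close>

lemma coherent_state_simps:
  "mean (coherent_state m) = m" "cov (coherent_state m) = mat 1"
  \<comment> \<open>The factor sinh 0 removes the phase term, whatever the value of
    \<open>Arg 0\<close>.\<close>
  by (simp_all add: coherent_state_def gaussian_of_params_def gaussian_cov_def)

lemma gaussian_state_coherent_state: "gaussian_state (coherent_state m)"
  unfolding gaussian_state_def coherent_state_def by auto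

lemma ergotropy_coherent_state: "ergotropy (coherent_state m) = m \<bullet> m / 2"
  by (simp add: coherent_state_def ergotropy_gaussian_of_params)

text \<open>The covariance stays a multiple of the identity, so AM-GM is an equality: the root of
  the determinant is 1 + 2 \<gamma>, and \<gamma> cancels against the added energy.\<close>

lemma ergotropy_output_coherent_state:
  assumes gain: "\<forall>l \<in> {1..t}. gain \<eta> k (js l) \<noteq> 0"
    and noise: "0 \<le> total_noise \<eta> k js t"
  shows "ergotropy (output_state \<eta> k js (coherent_state m) t) =
    (total_gain \<eta> k js t)\<^sup>2 * ergotropy (coherent_state m)"
proof -
  have "mat 1 + (2 * total_noise \<eta> k js t) *\<^sub>R mat 1 =
      (1 + 2 * total_noise \<eta> k js t) *\<^sub>R (mat 1 :: real^2^2)"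
    by (simp add: scaleR_add_left)
  then show ?thesis
    unfolding ergotropy_output_state[OF gain] energy_eq_ergotropy_plus
    using noise by (simp add: coherent_state_simps det_scaleR_2 add_divide_distrib)
qed

theorem mainTheorem1:
  fixes J :: nat and \<eta> k :: "nat \<Rightarrow> real" and E0 :: real
  assumes "J \<ge> 2"
    and "\<And>j. j \<in> {1..J} \<Longrightarrow> 0 < \<eta> j \<and> \<eta> j < 1"
    and "(\<Sum>j = 1..J. (\<eta> j)\<^sup>2) = 1"
    and "\<And>j. j \<in> {1..J} \<Longrightarrow> k j > 1"
    and "(\<Sum>j = 1..J. 1 / (k j)\<^sup>2) \<le> 1"
    and "E0 > 0"
  shows "(\<forall>m. ergotropy (coherent_state m) = E0 \<longleftrightarrow> m \<bullet> m = 2 * E0) \<and>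
    (\<exists>m :: real^2. m \<bullet> m = 2 * E0) \<and>
    (\<forall>t \<ge> 1. \<forall>js :: nat \<Rightarrow> nat. (\<forall>l \<in> {1..t}. js l \<in> {1..J}) \<longrightarrow>
      (\<forall>\<rho>. gaussian_state \<rho> \<and> ergotropy \<rho> = E0 \<longrightarrow>
         renormalized_ergotropy \<eta> k js t \<rho> \<le> 1 \<and>
         ergotropy_ratio \<eta> k js t \<rho> \<le> E0 / (E0 + total_noise \<eta> k js t + 1 / 2)) \<and>
      (\<forall>m. m \<bullet> m = 2 * E0 \<longrightarrow>
         renormalized_ergotropy \<eta> k js t (coherent_state m) = 1 \<and>
         ergotropy_ratio \<eta> k js t (coherent_state m) = E0 / (E0 + total_noise \<eta> k js t + 1 / 2) \<and>
         is_arg_max (renormalized_ergotropy \<eta> k js t)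
           (\<lambda>\<rho>. gaussian_state \<rho> \<and> ergotropy \<rho> = E0) (coherent_state m) \<and>
         is_arg_max (ergotropy_ratio \<eta> k js t)
           (\<lambda>\<rho>. gaussian_state \<rho> \<and> ergotropy \<rho> = E0) (coherent_state m)))"
proof -
  have "E0 > 0" by fact
  have ergotropy_eq: "ergotropy (coherent_state m) = E0 \<longleftrightarrow> m \<bullet> m = 2 * E0" for m
    by (auto simp: ergotropy_coherent_state)
  \<comment> \<open>This witness shows that a coherent state of ergotropy \<open>E0\<close> exists,
    so attainment is not vacuous.\<close>
  obtain v :: "real^2" where "norm v = sqrt (2 * E0)"
    using vector_choose_size[of "sqrt (2 * E0)"] \<open>E0 > 0\<close> by auto
  then have "v \<bullet> v = 2 * E0"
    using \<open>E0 > 0\<close> by (simp add: dot_square_norm)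
  have gain: "gain \<eta> k j \<noteq> 0" if "j \<in> {1..J}" for j
    using assms(2,4)[OF that] by (simp add: gain_def)
  \<comment> \<open>Attenuation contributes \<open>(k j)\<^sup>2 * (1 - (\<eta> j)\<^sup>2)\<close>
    and amplification \<open>(k j)\<^sup>2 - 1\<close>; each is nonnegative.\<close>
  have noise: "0 \<le> noise \<eta> k j" if "j \<in> {1..J}" for j
  proof -
    have "(\<eta> j)\<^sup>2 \<le> 1" "1 \<le> (k j)\<^sup>2"
      using assms(2,4)[OF that] by (auto intro: power_le_one one_le_power)
    then have "0 \<le> (k j)\<^sup>2 * (1 - (\<eta> j)\<^sup>2)" by simp
    then show ?thesis using \<open>1 \<le> (k j)\<^sup>2\<close> by (simp add: noise_def)
  qed
  have trajectory:
    "(\<forall>\<rho>. gaussian_state \<rho> \<and> ergotropy \<rho> = E0 \<longrightarrow>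
         renormalized_ergotropy \<eta> k js t \<rho> \<le> 1 \<and>
         ergotropy_ratio \<eta> k js t \<rho> \<le> E0 / (E0 + total_noise \<eta> k js t + 1 / 2)) \<and>
      (\<forall>m. m \<bullet> m = 2 * E0 \<longrightarrow>
         renormalized_ergotropy \<eta> k js t (coherent_state m) = 1 \<and>
         ergotropy_ratio \<eta> k js t (coherent_state m) = E0 / (E0 + total_noise \<eta> k js t + 1 / 2) \<and>
         is_arg_max (renormalized_ergotropy \<eta> k js t)
           (\<lambda>\<rho>. gaussian_state \<rho> \<and> ergotropy \<rho> = E0) (coherent_state m) \<and>
         is_arg_max (ergotropy_ratio \<eta> k js t)
           (\<lambda>\<rho>. gaussian_state \<rho> \<and> ergotropy \<rho> = E0) (coherent_state m))" (is "?bounds \<and> ?attained")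
    if js: "\<forall>l \<in> {1..t}. js l \<in> {1..J}" for t and js :: "nat \<Rightarrow> nat"
  proof -
    have g: "\<forall>l \<in> {1..t}. gain \<eta> k (js l) \<noteq> 0"
      using js gain by blast
    have n: "0 \<le> total_noise \<eta> k js t"
      using js noise by (intro total_noise_nonneg) blast
    have bounds: ?bounds
      using renormalized_ergotropy_le_1[OF g n] ergotropy_ratio_le[OF g n] \<open>E0 > 0\<close> by auto
    moreover have ?attained
    proof (intro allI impI)
      fix m :: "real^2"
      assume "m \<bullet> m = 2 * E0"
      then have m: "ergotropy (coherent_state m) = E0" using ergotropy_eq by simp
      have out: "ergotropy (output_state \<eta> k js (coherent_state m) t) = (total_gain \<eta> k js t)\<^sup>2 * E0"
        using ergotropy_output_coherent_state[OF g n] m by simp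
      have G: "total_gain \<eta> k js t \<noteq> 0" using g by (rule total_gain_nonzero)
      have mu: "renormalized_ergotropy \<eta> k js t (coherent_state m) = 1"
        using G \<open>E0 > 0\<close> by (simp add: renormalized_ergotropy_def out m)
      have "energy (coherent_state m) = E0 + 1 / 2"
        by (simp add: energy_eq_ergotropy_plus m coherent_state_simps)
      then have r: "ergotropy_ratio \<eta> k js t (coherent_state m)
          = E0 / (E0 + total_noise \<eta> k js t + 1 / 2)"
        using G unfolding ergotropy_ratio_def out energy_output_state[OF g]
        by (simp add: add_ac)
      show "renormalized_ergotropy \<eta> k js t (coherent_state m) = 1 \<and>
         ergotropy_ratio \<eta> k js t (coherent_state m) = E0 / (E0 + total_noise \<eta> k js t + 1 / 2) \<and>
         is_arg_max (renormalized_ergotropy \<eta> k js t)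
           (\<lambda>\<rho>. gaussian_state \<rho> \<and> ergotropy \<rho> = E0) (coherent_state m) \<and>
         is_arg_max (ergotropy_ratio \<eta> k js t)
           (\<lambda>\<rho>. gaussian_state \<rho> \<and> ergotropy \<rho> = E0) (coherent_state m)"
        \<comment> \<open>With the coherent values rewritten to the bounds themselves, maximality
          says that no admissible state exceeds them.\<close>
        unfolding is_arg_max_def mu r
        using bounds m gaussian_state_coherent_state by (auto simp: not_less)
    qed
    ultimately show ?thesis ..
  qed
  show ?thesis
    using ergotropy_eq \<open>v \<bullet> v = 2 * E0\<close> trajectory by blast
qed

end
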